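(* Let $m,n\in\mathbb{N}$, let $\mu$ be a probability measure on $M_{m,n}$ which is absolutely continuous with respect to Lebesgue measure, with density $f$, and let $\Psi:\mathbb{Z}^n\to\mathbb{R}_+$ satisfy $\Sigma_\Psi:=\sum_{\mathbf{a}\in\mathbb{Z}^n\setminus\{\mathbf{0}\}}\Psi(\mathbf{a})^m<\infty$; put $M_\Psi:=\sup\{\Psi(\mathbf{a}):\mathbf{a}\in\mathbb{Z}^n\setminus\{\mathbf{0}\}\}$. Let $\delta\in(0,1)$. Let $P_{\mathbf{0}}$ be a unit cube in $M_{m,n}$, for $\Delta\in M_{m,n}(\mathbb{Z})$ let $P_\Delta:=P_{\mathbf{0}}+\Delta$, and let $A$ be a finite subset of $M_{m,n}(\mathbb{Z})$ such that $$\mu\Big(\bigcup_{\Delta\in A}P_\Delta\Big)>1-\delta/2.$$ Assume there exists $p\in(1,\infty]$ such that $f\in L_p(P_\Delta)$ for every $\Delta\in A$, and let $\Sigma_f:=\sum_{\Delta\in A}\|f\|_{p,P_\Delta}$. Then $\mu(\mathcal{B}_{m,n}(\Psi,\kappa))\ge1-\delta$ holds with $$\kappa:=\frac12\min\left\{\frac{1}{M_\Psi},\ \left(\Sigma_\Psi^{-1}\left(\frac{\delta}{2\Sigma_f}\right)^{\frac p{p-1}}\right)^{1/m}\right\},$$ where the quotient $p/(p-1)$ is taken to be $1$ when $p=\infty$.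
   Context: $M_{m,n}$ is the space of real $m\times n$ matrices (identified with $\mathbb{R}^{mn}$), $M_{m,n}(\mathbb{Z})$ the set of those with integer entries. A unit cube in $M_{m,n}$ is a set $\{(x_{i,j}):\alpha_{i,j}\le x_{i,j}<\alpha_{i,j}+1\}$ for some fixed $(\alpha_{i,j})\in M_{m,n}$. For $x\in\mathbb{R}$, $\|x\|$ is the distance to the nearest integer; for $\mathbf{X}=(x_{i,j})$ and $\mathbf{a}\in\mathbb{Z}^n$, $\|\mathbf{X}\mathbf{a}\|:=\max_i\|\sum_j x_{i,j}a_j\|$. $\mathcal{B}_{m,n}(\Psi,\kappa):=\{\mathbf{X}\in M_{m,n}:\|\mathbf{X}\mathbf{a}\|>\kappa\Psi(\mathbf{a})\ \forall\mathbf{a}\in\mathbb{Z}^n\setminus\{\mathbf{0}\}\}$. $\|f\|_{p,X}:=(\int_X|f|^p)^{1/p}$ for finite $p$, and $\|f\|_{\infty,X}$ is the essential supremum of $|f|$ on $X$; $f\in L_p(X)$ means this is finite. *)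

theory Defs
  imports "HOL-Probability.Probability"
begin

text \<open>
  The space of real \<open>m \<times> n\<close> matrices is \<^typ>\<open>real ^ 'n ^ 'm\<close> with \<open>m = CARD('m)\<close> and
  \<open>n = CARD('n)\<close>, and \<^term>\<open>lborel\<close> at this type is Lebesgue measure on \<open>mn\<close>-dimensional
  Euclidean space.
\<close>

definition integer_matrices :: "(real ^ 'n ^ 'm) set" where
  "integer_matrices = {D. \<forall>i j. D $ i $ j \<in> \<int>}"

definition unit_cube :: "real ^ 'n ^ 'm \<Rightarrow> (real ^ 'n ^ 'm) set" where
  "unit_cube \<alpha> = {X. \<forall>i j. \<alpha> $ i $ j \<le> X $ i $ j \<and> X $ i $ j < \<alpha> $ i $ j + 1}"

definition nearest_int_dist :: "real \<Rightarrow> real" where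
  "nearest_int_dist x = infdist x \<int>"

definition mat_int_dist :: "real ^ 'n ^ 'm \<Rightarrow> int ^ 'n \<Rightarrow> real" where
  "mat_int_dist X a = (MAX i. nearest_int_dist (\<Sum>j\<in>UNIV. X $ i $ j * of_int (a $ j)))"

definition badly_approx :: "(int ^ 'n \<Rightarrow> real) \<Rightarrow> real \<Rightarrow> (real ^ 'n ^ 'm) set" where
  "badly_approx \<Psi> \<kappa> = {X. \<forall>a. a \<noteq> 0 \<longrightarrow> mat_int_dist X a > \<kappa> * \<Psi> a}"

text \<open>
  The norm takes the value \<open>\<infinity>\<close> exactly when \<open>f\<close> is not in \<open>L\<^sub>p(X)\<close>. It is meant for Borel
  measurable \<open>f\<close> and \<open>X\<close> and for \<open>1 \<le> p \<le> \<infinity>\<close>.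
\<close>

definition Lp_norm :: "ennreal \<Rightarrow> 'a::euclidean_space set \<Rightarrow> ('a \<Rightarrow> real) \<Rightarrow> ennreal" where
  "Lp_norm p X f =
     (if p = \<infinity> then esssup (restrict_space lborel X) (\<lambda>x. ennreal \<bar>f x\<bar>)
      else let I = (\<integral>\<^sup>+ x\<in>X. ennreal (\<bar>f x\<bar> powr enn2real p) \<partial>lborel)
           in if I = \<infinity> then \<infinity> else ennreal (enn2real I powr (1 / enn2real p)))"

end

theory Submission
  imports Defs
begin

text \<open>
  The bad set \<open>E\<close>, the complement of \<open>badly_approx \<Psi> \<kappa>\<close>, is the union over \<open>a \<noteq> 0\<close> of the sets
  \<open>mat_int_dist X a \<le> \<kappa> \<Psi> a\<close>. Since \<open>\<kappa> \<Psi> a \<le> 1 / 2\<close>, Fubini in a column \<open>k\<close> with \<open>a $ k \<noteq> 0\<close>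
  shows that the \<open>a\<close>-th set meets every unit cube in volume at most \<open>(2 \<kappa> \<Psi> a) ^ m\<close>. So \<open>E\<close> has
  volume at most \<open>(2 \<kappa>) ^ m S_\<Psi> \<le> (\<delta> / (2 S_f)) powr q\<close> in each cube, and Hoelder's inequality turns
  this into \<open>\<mu>\<close>-measure at most \<open>\<delta> / (2 S_f)\<close> times the \<open>L\<^sub>p\<close> norm of \<open>f\<close> on the cube. Summing over
  the chosen cubes gives \<open>\<delta> / 2\<close>, and the rest of the space contributes less than \<open>\<delta> / 2\<close>.
  If \<open>M_\<Psi>\<close>, \<open>S_\<Psi>\<close> or \<open>S_f\<close> is \<open>0\<close>, division by zero makes \<open>\<kappa> = 0\<close>, and the same estimates
  hold with bound \<open>0\<close>.
\<close>

section \<open>Countable subadditivity with unordered sums\<close>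

lemma emeasure_UN_le_infsum:
  fixes c :: "'i::countable \<Rightarrow> real"
  assumes "\<And>i. i \<in> I \<Longrightarrow> B i \<in> sets M"
    and "\<And>i. i \<in> I \<Longrightarrow> emeasure M (B i) \<le> ennreal (c i)"
    and nonneg: "\<And>i. i \<in> I \<Longrightarrow> 0 \<le> c i"
    and summable: "c summable_on I"
  shows "emeasure M (\<Union>i\<in>I. B i) \<le> ennreal (infsum c I)"
proof -
  define F where "F k = (if k \<in> to_nat ` I then B (from_nat k) else {})" for k
  define d where "d k = (if k \<in> to_nat ` I then c (from_nat k) else 0)" for k
  have "(\<Union>i\<in>I. B i) = (\<Union>k. F k)"
    unfolding F_def by auto
  moreover have F: "range F \<subseteq> sets M"
    using assms(1) by (auto simp: F_def)
  ultimately have "emeasure M (\<Union>i\<in>I. B i) \<le> (\<Sum>k. emeasure M (F k))"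
    by (simp add: emeasure_subadditive_countably)
  also have "\<dots> \<le> (\<Sum>k. ennreal (d k))"
    using assms(2) by (intro suminf_le) (auto simp: F_def d_def)
  also have "\<dots> \<le> ennreal (infsum c I)"
    unfolding suminf_eq_SUP
  proof (rule SUP_least)
    fix n
    define J where "J = {i \<in> I. to_nat i < n}"
    have inj: "inj_on to_nat J"
      by (simp add: inj_on_def)
    have "finite J"
      by (rule finite_imageD[OF _ inj], rule finite_subset[of _ "{..<n}"]) (auto simp: J_def)
    have "(\<Sum>k<n. d k) = (\<Sum>k\<in>to_nat ` J. d k)"
      by (rule sum.mono_neutral_right) (auto simp: J_def d_def)
    also have "\<dots> = (\<Sum>i\<in>J. c i)"
      unfolding sum.reindex[OF inj] by (intro sum.cong) (auto simp: d_def J_def)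
    also have "\<dots> \<le> infsum c I"
      using nonneg by (intro finite_sum_le_infsum summable \<open>finite J\<close>) (auto simp: J_def)
    finally have "(\<Sum>k<n. d k) \<le> infsum c I" .
    moreover have "(\<Sum>k<n. ennreal (d k)) = ennreal (\<Sum>k<n. d k)"
      using nonneg by (intro sum_ennreal) (auto simp: d_def)
    ultimately show "(\<Sum>k<n. ennreal (d k)) \<le> ennreal (infsum c I)"
      by (simp add: ennreal_leI)
  qed
  finally show ?thesis .
qed

section \<open>Integer distances and unit cubes\<close>

text \<open>The integers form a closed set, so the infimum in \<open>infdist\<close> is attained and
  the non-strict bound passes to an actual integer.\<close>

lemma nearest_int_dist_le_iff: "nearest_int_dist x \<le> r \<longleftrightarrow> (\<exists>k::int. \<bar>x - of_int k\<bar> \<le> r)"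
proof
  assume *: "nearest_int_dist x \<le> r"
  obtain y where "y \<in> \<int>" "infdist x \<int> = dist x y"
    using infdist_attains_inf[of \<int> x] closed_Ints by (metis Ints_0 empty_iff)
  with * show "\<exists>k::int. \<bar>x - of_int k\<bar> \<le> r"
    by (auto simp: nearest_int_dist_def dist_real_def elim!: Ints_cases)
next
  assume "\<exists>k::int. \<bar>x - of_int k\<bar> \<le> r"
  then obtain k :: int where "\<bar>x - of_int k\<bar> \<le> r" ..
  with infdist_le[of "of_int k" \<int> x] show "nearest_int_dist x \<le> r"
    by (simp add: nearest_int_dist_def dist_real_def)
qed

lemma continuous_on_nearest_int_dist [continuous_intros]:
  "continuous_on S g \<Longrightarrow> continuous_on S (\<lambda>x. nearest_int_dist (g x))"
  unfolding nearest_int_dist_def by (intro continuous_intros)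

lemma mat_int_dist_le_iff:
  "mat_int_dist X a \<le> r \<longleftrightarrow>
     (\<forall>i. nearest_int_dist (\<Sum>j\<in>UNIV. X $ i $ j * of_int (a $ j)) \<le> r)"
  unfolding mat_int_dist_def by (subst Max_le_iff) auto

lemma closed_mat_int_dist_le: "closed {X. mat_int_dist X a \<le> r}"
  unfolding mat_int_dist_le_iff
  by (intro closed_Collect_all closed_Collect_le continuous_intros)

lemma borel_unit_cube:
  fixes \<alpha> :: "real ^ 'n ^ 'm"
  shows "unit_cube \<alpha> \<in> sets borel"
proof -
  have [measurable]: "(\<lambda>X. X $ i $ j) \<in> borel_measurable (borel :: (real ^ 'n ^ 'm) measure)" for i j
    by (intro borel_measurable_continuous_onI continuous_intros)
  show ?thesis
    unfolding unit_cube_def by measurable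
qed

lemma unit_cube_translate: "(\<lambda>X. X + D) ` unit_cube \<alpha> = unit_cube (\<alpha> + D)"
proof (intro equalityI subsetI)
  fix X assume "X \<in> unit_cube (\<alpha> + D)"
  then have "X - D \<in> unit_cube \<alpha>"
    by (auto simp: unit_cube_def algebra_simps)
  then show "X \<in> (\<lambda>X. X + D) ` unit_cube \<alpha>"
    by (intro image_eqI[of _ _ "X - D"]) auto
qed (auto simp: unit_cube_def algebra_simps)

section \<open>One-dimensional strips\<close>

text \<open>Modulo 1, a window of length \<open>w\<close> can be moved so that it starts inside the
  unit interval. It then either fits or wraps around once, and in both cases the pieces have total
  length \<open>w\<close>.\<close>

lemma emeasure_Int_window:
  fixes \<alpha> u w :: real
  assumes "0 \<le> w" "w \<le> 1"
  shows "emeasure lborel {x \<in> {\<alpha>..<\<alpha> + 1}. \<exists>l::int. u \<le> x - of_int l \<and> x - of_int l \<le> u + w}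
           \<le> ennreal w"
proof -
  \<comment> \<open>\<open>v\<close> is the representative of \<open>u\<close> modulo 1 in the unit
    interval starting at \<alpha>.\<close>
  define v where "v = u - of_int \<lfloor>u - \<alpha>\<rfloor>"
  have v: "\<alpha> \<le> v" "v < \<alpha> + 1"
    unfolding v_def by linarith+
  \<comment> \<open>The second interval is the part that wraps around; if nothing wraps, it shrinks
    to the single point \<alpha>, of measure 0.\<close>
  define W where "W = {v..min (v + w) (\<alpha> + 1)} \<union> {\<alpha>..max \<alpha> (v + w - 1)}"
  have "x \<in> W" if x: "\<alpha> \<le> x" "x < \<alpha> + 1" and l: "u \<le> x - of_int l" "x - of_int l \<le> u + w"
    for x and l :: int
  proof -
    define l' where "l' = l + \<lfloor>u - \<alpha>\<rfloor>"
    have l': "v + of_int l' \<le> x" "x \<le> v + w + of_int l'"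
      using l by (simp_all add: v_def l'_def)
    \<comment> \<open>Only two translates of the window can reach the unit interval:
      \<open>l' = 0\<close> gives the first piece of \<open>W\<close>, and \<open>l' = -1\<close>
      the wrapped one.\<close>
    have "of_int l' < (1::real)" "of_int l' > (-2::real)"
      using l' v x assms by linarith+
    then have "l' = 0 \<or> l' = -1"
      by linarith
    then show ?thesis
      using l' x v by (auto simp: W_def)
  qed
  then have "{x \<in> {\<alpha>..<\<alpha> + 1}. \<exists>l::int. u \<le> x - of_int l \<and> x - of_int l \<le> u + w} \<subseteq> W"
    by auto
  then have "emeasure lborel {x \<in> {\<alpha>..<\<alpha> + 1}. \<exists>l::int. u \<le> x - of_int l \<and> x - of_int l \<le> u + w}
      \<le> emeasure lborel W"
    by (rule emeasure_mono) (simp add: W_def)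
  also have "\<dots> \<le> emeasure lborel {v..min (v + w) (\<alpha> + 1)} + emeasure lborel {\<alpha>..max \<alpha> (v + w - 1)}"
    unfolding W_def by (rule emeasure_subadditive) auto
  also have "\<dots> = ennreal ((min (v + w) (\<alpha> + 1) - v) + (max \<alpha> (v + w - 1) - \<alpha>))"
    using v assms by (simp add: ennreal_plus[symmetric] del: ennreal_plus)
  also have "\<dots> = ennreal w"
    by (rule arg_cong[where f = ennreal]) auto
  finally show ?thesis .
qed

text \<open>
  The integers \<open>k\<close> with \<open>\<bar>c + x b - k\<bar> \<le> r\<close> are sorted by their residues modulo \<open>b\<close>: each of the
  \<open>\<bar>b\<bar>\<close> residues confines \<open>x\<close>, up to integer translations, to a window of length \<open>2 r / \<bar>b\<bar>\<close>.
\<close>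

lemma emeasure_int_dist_strip:
  fixes c r \<alpha> :: real and b :: int
  assumes "b \<noteq> 0" "0 \<le> r" "r \<le> 1 / 2"
  shows "emeasure lborel {x \<in> {\<alpha>..<\<alpha> + 1}. nearest_int_dist (c + x * of_int b) \<le> r}
           \<le> ennreal (2 * r)"
proof -
  define w where "w = 2 * r / of_int \<bar>b\<bar>"
  define u where "u s = (of_int s - c) / of_int b - r / of_int \<bar>b\<bar>" for s :: int
  define V where "V s = {x \<in> {\<alpha>..<\<alpha> + 1}. \<exists>l::int. u s \<le> x - of_int l \<and> x - of_int l \<le> u s + w}"
    for s
  have b: "of_int \<bar>b\<bar> \<ge> (1::real)"
    using \<open>b \<noteq> 0\<close> by linarith
  have w: "0 \<le> w" "w \<le> 1"
    using assms b by (auto simp: w_def divide_simps)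
  have V_borel: "V s \<in> sets lborel" for s
    unfolding V_def by measurable
  have "x \<in> (\<Union>s\<in>{0..<\<bar>b\<bar>}. V s)"
    if x: "\<alpha> \<le> x" "x < \<alpha> + 1" and k: "\<bar>c + x * of_int b - of_int k\<bar> \<le> r" for x and k :: int
  proof -
    define s where "s = k mod \<bar>b\<bar>"
    \<comment> \<open>The residue is taken modulo the absolute value of \<open>b\<close>; the factor
      \<open>sgn b\<close> makes \<open>k = s + b * l\<close> true for negative \<open>b\<close> as
      well.\<close>
    define l where "l = sgn b * (k div \<bar>b\<bar>)"
    have "k = s + \<bar>b\<bar> * (k div \<bar>b\<bar>)"
      by (simp add: s_def)
    also have "\<bar>b\<bar> * (k div \<bar>b\<bar>) = b * l"
      by (simp add: l_def abs_sgn mult.assoc)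
    finally have kl: "k = s + b * l" .
    \<comment> \<open>\<open>z\<close> is the signed offset of \<open>x - l\<close> from the centre
      of the window for residue \<open>s\<close>, whose half-width is \<open>r\<close> divided by
      the absolute value of \<open>b\<close>.\<close>
    define z where "z = x - of_int l - (of_int s - c) / of_int b"
    have "c + x * of_int b - of_int k = of_int b * z"
      using \<open>b \<noteq> 0\<close> unfolding kl z_def by (simp add: field_simps)
    then have "of_int \<bar>b\<bar> * \<bar>z\<bar> \<le> r"
      using k by (simp add: abs_mult)
    then have "\<bar>z\<bar> \<le> r / of_int \<bar>b\<bar>"
      using b by (simp add: pos_le_divide_eq mult.commute)
    moreover have "u s + w = (of_int s - c) / of_int b + r / of_int \<bar>b\<bar>"
      by (simp add: u_def w_def)
    ultimately have "u s \<le> x - of_int l \<and> x - of_int l \<le> u s + w"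
      unfolding z_def u_def by linarith
    moreover have "s \<in> {0..<\<bar>b\<bar>}"
      using \<open>b \<noteq> 0\<close> by (simp add: s_def)
    ultimately show ?thesis
      using x by (auto simp: V_def)
  qed
  then have "{x \<in> {\<alpha>..<\<alpha> + 1}. nearest_int_dist (c + x * of_int b) \<le> r} \<subseteq> (\<Union>s\<in>{0..<\<bar>b\<bar>}. V s)"
    unfolding nearest_int_dist_le_iff by auto
  then have "emeasure lborel {x \<in> {\<alpha>..<\<alpha> + 1}. nearest_int_dist (c + x * of_int b) \<le> r}
      \<le> emeasure lborel (\<Union>s\<in>{0..<\<bar>b\<bar>}. V s)"
    using V_borel by (intro emeasure_mono sets.finite_UN) auto
  also have "\<dots> \<le> (\<Sum>s\<in>{0..<\<bar>b\<bar>}. emeasure lborel (V s))"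
    using V_borel by (intro emeasure_subadditive_finite) auto
  also have "\<dots> \<le> (\<Sum>s\<in>{0..<\<bar>b\<bar>}. ennreal w)"
    unfolding V_def by (intro sum_mono emeasure_Int_window w)
  also have "\<dots> = ennreal (\<Sum>s\<in>{0..<\<bar>b\<bar>}. w)"
    using w by (intro sum_ennreal)
  also have "(\<Sum>s\<in>{0..<\<bar>b\<bar>}. w) = 2 * r"
    using \<open>b \<noteq> 0\<close> by (simp add: w_def)
  finally show ?thesis .
qed

section \<open>Hoelder's inequality on a subset of a cube\<close>

text \<open>This is Hoelder's inequality for \<open>f\<close> and the indicator of \<open>G\<close>:
  as \<open>q\<close> is the exponent conjugate to \<open>p\<close>, the number \<open>t\<close>
  bounds the \<open>L_q\<close> norm of that indicator. For finite \<open>p\<close> it follows by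
  integrating a scaled Young inequality.\<close>

lemma set_nn_integral_le_Lp_norm:
  fixes f :: "'a::euclidean_space \<Rightarrow> real"
  assumes [measurable]: "f \<in> borel_measurable borel" "X \<in> sets borel" "G \<in> sets borel"
    and "G \<subseteq> X" "1 < p" and fin: "Lp_norm p X f < \<infinity>"
    and q: "q = (if p = \<infinity> then 1 else enn2real p / (enn2real p - 1))"
    and "0 \<le> t" and G: "emeasure lborel G \<le> ennreal (t powr q)"
  shows "(\<integral>\<^sup>+x\<in>G. ennreal (f x) \<partial>lborel) \<le> ennreal (enn2real (Lp_norm p X f) * t)"
proof -
  define N where "N = enn2real (Lp_norm p X f)"
  have N: "Lp_norm p X f = ennreal N" "0 \<le> N"
    using fin by (auto simp: N_def less_top)
  \<comment> \<open>This serves twice: with \<open>C = N\<close> for infinite \<open>p\<close>, and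
    with \<open>C = 0\<close> when the norm vanishes.\<close>
  have le_of_AE: "(\<integral>\<^sup>+x\<in>G. ennreal (f x) \<partial>lborel) \<le> ennreal C * emeasure lborel G"
    if "AE x in lborel. x \<in> X \<longrightarrow> \<bar>f x\<bar> \<le> C" for C
  proof -
    have "(\<integral>\<^sup>+x\<in>G. ennreal (f x) \<partial>lborel) \<le> (\<integral>\<^sup>+x\<in>G. ennreal C \<partial>lborel)"
      using that \<open>G \<subseteq> X\<close>
      by (intro nn_integral_mono_AE) (auto simp: indicator_def intro!: ennreal_leI)
    then show ?thesis
      by (simp add: nn_integral_cmult_indicator)
  qed
  show ?thesis
  proof (cases "p = \<infinity>")
    case True
    then have "AE x in restrict_space lborel X. ennreal \<bar>f x\<bar> \<le> ennreal N"
      using N esssup_AE[of "\<lambda>x. ennreal \<bar>f x\<bar>" "restrict_space lborel X"] by (simp add: Lp_norm_def)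
    then have "(\<integral>\<^sup>+x\<in>G. ennreal (f x) \<partial>lborel) \<le> ennreal N * emeasure lborel G"
      using N by (intro le_of_AE) (simp add: AE_restrict_space_iff)
    also have "\<dots> \<le> ennreal N * ennreal t"
      using G True \<open>0 \<le> t\<close> by (intro mult_left_mono) (simp_all add: q)
    finally show ?thesis
      using N by (simp add: ennreal_mult'' N_def[symmetric] \<open>0 \<le> t\<close>)
  next
    case False
    define r where "r = enn2real p"
    have p: "p = ennreal r" "1 < r"
      using False \<open>1 < p\<close> by (cases p; simp add: r_def; fail)+
    have q: "q = r / (r - 1)"
      using False q by (simp add: r_def)
    have "1 < q" "1 / r + 1 / q = 1"
      using p(2) by (auto simp: q field_simps)
    define I where "I = (\<integral>\<^sup>+x\<in>X. ennreal (\<bar>f x\<bar> powr r) \<partial>lborel)"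
    have "I \<noteq> \<infinity>"
      using fin False by (auto simp: Lp_norm_def I_def r_def Let_def split: if_splits)
    then have "N = enn2real I powr (1 / r)"
      using False by (simp add: N_def Lp_norm_def I_def r_def Let_def)
    then have "N powr r = enn2real I"
      using p(2) by (simp add: powr_powr)
    then have I: "I = ennreal (N powr r)"
      using \<open>I \<noteq> \<infinity>\<close> by (simp add: less_top)
    show ?thesis
    \<comment> \<open>Young's inequality is applied after division by \<open>N\<close> and by
      \<open>t\<close>, so the zero cases are settled first: either \<open>f\<close> vanishes almost
      everywhere on \<open>X\<close>, or \<open>G\<close> is a null set.\<close>
    proof (cases "N = 0 \<or> t = 0")
      case True
      then have "(\<integral>\<^sup>+x\<in>G. ennreal (f x) \<partial>lborel) \<le> 0"
      proof
        assume "N = 0"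
        then have "I = 0"
          using I by simp
        then have "AE x in lborel. x \<in> X \<longrightarrow> \<bar>f x\<bar> \<le> 0"
          unfolding I_def by (subst (asm) nn_integral_0_iff_AE) (auto simp: indicator_def elim: AE_mp)
        from le_of_AE[OF this] show ?thesis by simp
      next
        assume "t = 0"
        then have "AE x in lborel. x \<notin> G"
          using G by (intro AE_not_in) (simp add: null_sets_def)
        then have "(\<integral>\<^sup>+x\<in>G. ennreal (f x) \<partial>lborel) = 0"
          by (subst nn_integral_0_iff_AE) (auto simp: indicator_def elim: AE_mp)
        then show ?thesis by simp
      qed
      with True show ?thesis by (simp add: N_def[symmetric])
    next
      case False
      then have pos: "N > 0" "t > 0"
        using N \<open>0 \<le> t\<close> by auto
      \<comment> \<open>The coefficients arise from Young's inequality for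
        \<open>\<bar>f x\<bar> / N\<close> and \<open>1 / t\<close>, multiplied by
        \<open>N * t\<close>. After integration the two terms are at most \<open>N * t / r\<close>
        and \<open>N * t / q\<close>, which add up to \<open>N * t\<close>.\<close>
      define A where "A = N * t / (r * N powr r)"
      define B where "B = N * t / (q * t powr q)"
      have AB: "A \<ge> 0" "B \<ge> 0"
        using pos p(2) \<open>1 < q\<close> by (auto simp: A_def B_def)
      have young: "f x \<le> A * \<bar>f x\<bar> powr r + B" for x
      proof -
        have "\<bar>f x\<bar> / N * (1 / t) \<le> (\<bar>f x\<bar> / N) powr r / r + (1 / t) powr q / q"
          using p(2) \<open>1 < q\<close> \<open>1 / r + 1 / q = 1\<close> pos by (intro Youngs_inequality) auto
        then have "N * t * (\<bar>f x\<bar> / N * (1 / t))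
            \<le> N * t * ((\<bar>f x\<bar> / N) powr r / r + (1 / t) powr q / q)"
          using pos by (intro mult_left_mono) auto
        also have "\<dots> = A * \<bar>f x\<bar> powr r + B"
          using pos by (simp add: A_def B_def powr_divide distrib_left mult_ac)
        also have "N * t * (\<bar>f x\<bar> / N * (1 / t)) = \<bar>f x\<bar>"
          using pos by simp
        finally show ?thesis by linarith
      qed
      \<comment> \<open>Only the term with \<open>A\<close> is enlarged from \<open>G\<close> to
        \<open>X\<close>, where its integral is known from the norm; the constant \<open>B\<close>
        must stay on \<open>G\<close>.\<close>
      have "(\<integral>\<^sup>+x\<in>G. ennreal (f x) \<partial>lborel)
          \<le> (\<integral>\<^sup>+x. ennreal A * (ennreal (\<bar>f x\<bar> powr r) * indicator X x) + ennreal B * indicator G x \<partial>lborel)"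
        using young \<open>G \<subseteq> X\<close> AB
        by (intro nn_integral_mono)
           (auto simp: indicator_def ennreal_mult[symmetric] ennreal_plus[symmetric]
              simp del: ennreal_plus intro!: ennreal_leI)
      also have "\<dots> = ennreal A * I + ennreal B * emeasure lborel G"
        unfolding I_def
        by (subst nn_integral_add) (auto simp: nn_integral_cmult nn_integral_cmult_indicator)
      also have "\<dots> \<le> ennreal A * ennreal (N powr r) + ennreal B * ennreal (t powr q)"
        unfolding I using G by (intro add_left_mono mult_left_mono) auto
      also have "\<dots> = ennreal (A * N powr r + B * t powr q)"
        using AB by (simp add: ennreal_mult)
      also have "A * N powr r + B * t powr q = N * t * (1 / r + 1 / q)"
        using pos p(2) \<open>1 < q\<close> by (simp add: A_def B_def distrib_left)
      finally show ?thesis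
        using \<open>1 / r + 1 / q = 1\<close> by (simp add: N_def)
    qed
  qed
qed

section \<open>Volume of a strip in a matrix cube\<close>

lemma emeasure_unit_cube_int_dist_le:
  fixes \<alpha> :: "real ^ 'n ^ 'm" and a :: "int ^ 'n"
  assumes "a \<noteq> 0" "0 \<le> r" "r \<le> 1 / 2"
  shows "emeasure lborel (unit_cube \<alpha> \<inter> {X. mat_int_dist X a \<le> r}) \<le> ennreal ((2 * r) ^ CARD('m))"
proof -
  obtain k where k: "a $ k \<noteq> 0"
    using \<open>a \<noteq> 0\<close> by (auto simp: vec_eq_iff)
  define S where "S = unit_cube \<alpha> \<inter> {X. mat_int_dist X a \<le> r}"
  have S [measurable]: "S \<in> sets borel"
    unfolding S_def by (intro sets.Int borel_unit_cube borel_closed closed_mat_int_dist_le)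
  \<comment> \<open>The matrix units are exactly the elements of \<open>Basis\<close>, so they index
    the coordinates of the product measure behind \<open>lborel\<close>.\<close>
  define e where "e i j = (axis i (axis j 1) :: real ^ 'n ^ 'm)" for i j
  have e_Basis: "e i j \<in> Basis" for i j
    by (simp add: e_def)
  have e_eq_iff: "e i j = e i' j' \<longleftrightarrow> i = i' \<and> j = j'" for i j i' j'
    by (auto simp: e_def axis_eq_axis)
  have Basis_eq: "Basis = (\<Union>i j. {e i j})"
    by (auto simp: Basis_vec_def e_def)
  have inner_e: "X \<bullet> e i j = X $ i $ j" for X i j
    by (simp add: e_def inner_axis)
  define K where "K = range (\<lambda>i. e i k)"
  define J where "J = Basis - K"
  have fin: "finite J" "finite K" and disj: "J \<inter> K = {}" and JK: "J \<union> K = Basis"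
    using e_Basis by (auto simp: J_def K_def)
  have card_K: "card K = CARD('m)"
    unfolding K_def by (rule card_image) (simp add: inj_on_def e_eq_iff)
  define h where "h x = (\<Sum>b\<in>Basis. x b *\<^sub>R b)" for x :: "real ^ 'n ^ 'm \<Rightarrow> real"
  have h_nth: "h x $ i $ j = x (e i j)" for x i j
    by (simp only: inner_e[symmetric] h_def inner_sum_left_Basis e_Basis)
  have [measurable]: "h \<in> borel_measurable (\<Pi>\<^sub>M b\<in>Basis. lborel)"
    unfolding h_def by measurable
  define Q where "Q = Pi\<^sub>E J (\<lambda>b. {\<alpha> \<bullet> b..<\<alpha> \<bullet> b + 1})"
  define c where "c x b = (\<Sum>j\<in>UNIV - {k}. x (e (SOME i. b = e i k) j) * of_int (a $ j))"
    for x :: "real ^ 'n ^ 'm \<Rightarrow> real" and b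
  define T where "T x b = {t \<in> {\<alpha> \<bullet> b..<\<alpha> \<bullet> b + 1}. nearest_int_dist (c x b + t * of_int (a $ k)) \<le> r}"
    for x b
  have T [measurable]: "T x b \<in> sets lborel" for x b
  proof -
    have "T x b = {\<alpha> \<bullet> b..<\<alpha> \<bullet> b + 1} \<inter> {t. nearest_int_dist (c x b + t * of_int (a $ k)) \<le> r}"
      by (auto simp: T_def)
    also have "\<dots> \<in> sets lborel"
      by (simp, rule sets.Int, simp, intro borel_closed closed_Collect_le continuous_intros)
    finally show ?thesis .
  qed
  interpret product_sigma_finite "\<lambda>_. lborel :: real measure"
    by unfold_locales
  have split: "indicator S (h (merge J K (x, y))) \<le> (indicator Q x * indicator (Pi\<^sub>E K (T x)) y :: ennreal)"
    if x: "x \<in> space (\<Pi>\<^sub>M b\<in>J. lborel)" and y: "y \<in> space (\<Pi>\<^sub>M b\<in>K. lborel)" for x y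
  proof (cases "h (merge J K (x, y)) \<in> S")
    case True
    define z where "z = merge J K (x, y)"
    have zx: "z b = x b" if "b \<in> J" for b
      using that by (simp add: z_def merge_def)
    have zy: "z b = y b" if "b \<in> K" for b
      using that disj by (auto simp: z_def merge_def)
    have cube: "\<alpha> \<bullet> b \<le> z b \<and> z b < \<alpha> \<bullet> b + 1" if "b \<in> Basis" for b
      using that True unfolding Basis_eq S_def unit_cube_def z_def[symmetric]
      by (auto simp: h_nth inner_e)
    have strip: "nearest_int_dist (\<Sum>j\<in>UNIV. z (e i j) * of_int (a $ j)) \<le> r" for i
      using True unfolding S_def mat_int_dist_le_iff z_def[symmetric] by (auto simp: h_nth)
    have "x \<in> Q"
      using x cube zx JK by (fastforce simp: Q_def space_PiM PiE_def)
    moreover have "y b \<in> T x b" if "b \<in> K" for b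
    proof -
      obtain i where b: "b = e i k"
        using \<open>b \<in> K\<close> by (auto simp: K_def)
      have "(\<Sum>j\<in>UNIV. z (e i j) * of_int (a $ j))
          = (\<Sum>j\<in>UNIV - {k}. z (e i j) * of_int (a $ j)) + z (e i k) * of_int (a $ k)"
        by (simp add: sum.remove[of UNIV k] add.commute)
      also have "(\<Sum>j\<in>UNIV - {k}. z (e i j) * of_int (a $ j)) = c x b"
        unfolding c_def
      proof (rule sum.cong)
        fix j assume "j \<in> UNIV - {k}"
        then have "e i j \<in> J"
          using e_Basis by (auto simp: J_def K_def e_eq_iff)
        moreover have "(SOME i'. b = e i' k) = i"
          unfolding b e_eq_iff by auto
        ultimately show "z (e i j) * of_int (a $ j) = x (e (SOME i'. b = e i' k) j) * of_int (a $ j)"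
          by (simp add: zx)
      qed simp
      finally show ?thesis
        using strip[of i] cube[of b] e_Basis[of i k] zy[OF that] by (simp add: T_def b)
    qed
    then have "y \<in> Pi\<^sub>E K (T x)"
      using y by (auto simp: space_PiM PiE_def)
    ultimately show ?thesis by (simp add: indicator_def)
  qed simp
  have "emeasure lborel S = (\<integral>\<^sup>+x. indicator S (h x) \<partial>(\<Pi>\<^sub>M b\<in>J \<union> K. lborel))"
    unfolding JK by (subst lborel_eq) (simp add: h_def[symmetric] nn_integral_distr flip: nn_integral_indicator)
  also have "\<dots> = (\<integral>\<^sup>+x. (\<integral>\<^sup>+y. indicator S (h (merge J K (x, y))) \<partial>(\<Pi>\<^sub>M b\<in>K. lborel)) \<partial>(\<Pi>\<^sub>M b\<in>J. lborel))"
    by (rule product_nn_integral_fold[OF disj fin]) (simp add: JK)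
  also have "\<dots> \<le> (\<integral>\<^sup>+x. (\<integral>\<^sup>+y. indicator Q x * indicator (Pi\<^sub>E K (T x)) y \<partial>(\<Pi>\<^sub>M b\<in>K. lborel)) \<partial>(\<Pi>\<^sub>M b\<in>J. lborel))"
    by (intro nn_integral_mono split)
  also have "\<dots> = (\<integral>\<^sup>+x. indicator Q x * (\<Prod>b\<in>K. emeasure lborel (T x b)) \<partial>(\<Pi>\<^sub>M b\<in>J. lborel))"
    using fin T by (simp add: nn_integral_cmult sets_PiM_I_finite emeasure_PiM)
  also have "\<dots> \<le> (\<integral>\<^sup>+x. indicator Q x * ennreal ((2 * r) ^ CARD('m)) \<partial>(\<Pi>\<^sub>M b\<in>J. lborel))"
  proof (intro nn_integral_mono mult_left_mono)
    fix x
    have "(\<Prod>b\<in>K. emeasure lborel (T x b)) \<le> (\<Prod>b\<in>K. ennreal (2 * r))"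
      unfolding T_def using assms k by (intro prod_mono_ennreal emeasure_int_dist_strip) auto
    also have "\<dots> = ennreal ((2 * r) ^ CARD('m))"
      using assms by (simp add: card_K ennreal_power)
    finally show "(\<Prod>b\<in>K. emeasure lborel (T x b)) \<le> ennreal ((2 * r) ^ CARD('m))" .
  qed simp
  also have "\<dots> = emeasure (\<Pi>\<^sub>M b\<in>J. lborel) Q * ennreal ((2 * r) ^ CARD('m))"
    unfolding Q_def using fin
    by (subst nn_integral_multc) (auto intro!: sets_PiM_I_finite)
  also have "emeasure (\<Pi>\<^sub>M b\<in>J. lborel) Q = 1"
    unfolding Q_def using fin by (subst emeasure_PiM) auto
  finally show ?thesis
    by (simp add: S_def)
qed

section \<open>The measure of the badly approximable matrices\<close>

theorem theorem2:
  fixes \<mu> :: "(real ^ 'n ^ 'm) measure"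
    and f :: "real ^ 'n ^ 'm \<Rightarrow> real"
    and \<Psi> :: "int ^ 'n \<Rightarrow> real"
    and P\<^sub>0 :: "(real ^ 'n ^ 'm) set"
    and P :: "real ^ 'n ^ 'm \<Rightarrow> (real ^ 'n ^ 'm) set"
    and A :: "(real ^ 'n ^ 'm) set"
    and p :: ennreal
    and \<delta> \<kappa> S_\<Psi> M_\<Psi> S_f q :: real
  assumes "prob_space \<mu>"
    and "absolutely_continuous lborel \<mu>"
    and "f \<in> borel_measurable lborel"
    and "AE X in lborel. 0 \<le> f X"
    and "\<mu> = density lborel (\<lambda>X. ennreal (f X))"
    and "\<And>a. 0 \<le> \<Psi> a"
    and "(\<lambda>a. \<Psi> a ^ CARD('m)) summable_on (UNIV - {0})"
    and "S_\<Psi> = (\<Sum>\<^sub>\<infinity>a\<in>UNIV - {0}. \<Psi> a ^ CARD('m))"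
    and "M_\<Psi> = (SUP a\<in>UNIV - {0}. \<Psi> a)"
    and "0 < \<delta>" and "\<delta> < 1"
    and "\<exists>\<alpha>. P\<^sub>0 = unit_cube \<alpha>"
    and "\<And>\<Delta>. \<Delta> \<in> integer_matrices \<Longrightarrow> P \<Delta> = (\<lambda>X. X + \<Delta>) ` P\<^sub>0"
    and "finite A" and "A \<subseteq> integer_matrices"
    and "measure \<mu> (\<Union>\<Delta>\<in>A. P \<Delta>) > 1 - \<delta> / 2"
    and "1 < p"
    and "\<And>\<Delta>. \<Delta> \<in> A \<Longrightarrow> Lp_norm p (P \<Delta>) f < \<infinity>"
    and "S_f = (\<Sum>\<Delta>\<in>A. enn2real (Lp_norm p (P \<Delta>) f))"
    and "q = (if p = \<infinity> then 1 else enn2real p / (enn2real p - 1))"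
    and "\<kappa> = 1 / 2 * min (1 / M_\<Psi>)
                        ((inverse S_\<Psi> * (\<delta> / (2 * S_f)) powr q) powr (1 / real CARD('m)))"
  shows "measure \<mu> (badly_approx \<Psi> \<kappa>) \<ge> 1 - \<delta>"
proof -
  interpret prob_space \<mu> by fact
  note \<Psi>_nonneg = \<open>\<And>a. 0 \<le> \<Psi> a\<close> and \<Psi>_summable = \<open>(\<lambda>a. \<Psi> a ^ CARD('m)) summable_on (UNIV - {0})\<close>
  have [measurable]: "f \<in> borel_measurable borel"
    using \<open>f \<in> borel_measurable lborel\<close> by simp
  have sets_\<mu>: "sets \<mu> = sets borel" and space_\<mu>: "space \<mu> = UNIV"
    by (simp_all add: \<open>\<mu> = density lborel _\<close>)
  define I where "I = (UNIV - {0} :: (int ^ 'n) set)"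
  \<comment> \<open>A nonzero integer vector is exhibited so that \<open>M_\<Psi>\<close> bounds at
    least one nonnegative value and is itself nonnegative.\<close>
  have "axis undefined 1 \<in> I"
    by (simp add: I_def axis_eq_0_iff)
  note summable = \<Psi>_summable[folded I_def]
  have S_nonneg: "0 \<le> S_\<Psi>"
    unfolding \<open>S_\<Psi> = _\<close> using \<Psi>_nonneg by (intro infsum_nonneg) simp
  \<comment> \<open>A real supremum is an upper bound only for a set that is bounded above. Each
    term of the convergent sum is at most \<open>S_\<Psi>\<close>, so its root bounds every \<Psi>
    value.\<close>
  have bdd: "bdd_above (\<Psi> ` I)"
  proof (rule bdd_aboveI2)
    fix a assume "a \<in> I"
    have "\<Psi> a ^ CARD('m) \<le> S_\<Psi>"
      using finite_sum_le_infsum[OF summable, of "{a}"] \<open>a \<in> I\<close> \<Psi>_nonneg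
      by (simp add: \<open>S_\<Psi> = _\<close> I_def)
    then have "\<Psi> a ^ CARD('m) \<le> (root CARD('m) S_\<Psi>) ^ CARD('m)"
      using S_nonneg by (simp add: real_root_pow_pos2)
    then show "\<Psi> a \<le> root CARD('m) S_\<Psi>"
      using power_mono_iff[of "\<Psi> a" "root CARD('m) S_\<Psi>" "CARD('m)"] S_nonneg \<Psi>_nonneg
      by (simp del: real_root_pow_pos2)
  qed
  have M_upper: "\<Psi> a \<le> M_\<Psi>" if "a \<in> I" for a
    unfolding \<open>M_\<Psi> = _\<close> using that bdd by (intro cSUP_upper) (auto simp: I_def)
  have M_nonneg: "0 \<le> M_\<Psi>"
    using M_upper[OF \<open>axis undefined 1 \<in> I\<close>] \<Psi>_nonneg[of "axis undefined 1"] by linarith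
  have S_f_nonneg: "0 \<le> S_f"
    unfolding \<open>S_f = _\<close> by (intro sum_nonneg) simp
  define t where "t = \<delta> / (2 * S_f)"
  have "0 \<le> t"
    using S_f_nonneg \<open>0 < \<delta>\<close> by (simp add: t_def)
  define V where "V = (inverse S_\<Psi> * t powr q) powr (1 / real CARD('m))"
  have \<kappa>: "2 * \<kappa> = min (1 / M_\<Psi>) V"
    using \<open>\<kappa> = _\<close> by (simp add: V_def t_def)
  have "0 \<le> V"
    by (simp add: V_def)
  then have "0 \<le> \<kappa>"
    using \<kappa> M_nonneg by (smt (verit) divide_nonneg_nonneg)
  \<comment> \<open>The first entry of the minimum provides the radius condition of the strip
    estimate; for \<open>M_\<Psi> = 0\<close> the product \<open>1 / M_\<Psi> * M_\<Psi>\<close> is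
    0, still at most 1.\<close>
  have half: "\<kappa> * \<Psi> a \<le> 1 / 2" if "a \<in> I" for a
  proof -
    have "2 * \<kappa> * \<Psi> a \<le> 1 / M_\<Psi> * M_\<Psi>"
      using \<kappa> M_upper[OF that] M_nonneg \<Psi>_nonneg by (intro mult_mono) auto
    also have "\<dots> \<le> 1"
      by simp
    finally show ?thesis by simp
  qed
  \<comment> \<open>The second entry of the minimum is chosen so that the summed strip volumes match
    the hypothesis on \<open>G\<close> in the Hoelder estimate.\<close>
  have volume: "(2 * \<kappa>) ^ CARD('m) * S_\<Psi> \<le> t powr q"
  proof -
    have "(2 * \<kappa>) ^ CARD('m) \<le> V ^ CARD('m)"
      using \<open>0 \<le> \<kappa>\<close> \<kappa> by (intro power_mono) linarith+
    also have "V ^ CARD('m) = inverse S_\<Psi> * t powr q"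
      using S_nonneg by (simp add: V_def powr_powr flip: powr_realpow')
    finally have "(2 * \<kappa>) ^ CARD('m) * S_\<Psi> \<le> inverse S_\<Psi> * t powr q * S_\<Psi>"
      using S_nonneg by (intro mult_right_mono)
    then show ?thesis
      by (cases "S_\<Psi> = 0") (simp_all add: field_simps)
  qed
  define N where "N a = {X :: real ^ 'n ^ 'm. mat_int_dist X a \<le> \<kappa> * \<Psi> a}" for a
  define E where "E = (\<Union>a\<in>I. N a)"
  have N_borel: "N a \<in> sets borel" for a
    unfolding N_def by (intro borel_closed closed_mat_int_dist_le)
  \<comment> \<open>The index type \<open>int ^ 'n\<close> is countable, so the union stays
    Borel.\<close>
  have E_borel: "E \<in> sets borel"
    unfolding E_def by (rule sets.countable_UN'') (auto simp: N_borel)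
  have badly_approx_eq: "badly_approx \<Psi> \<kappa> = - E"
    by (auto simp: badly_approx_def E_def N_def I_def not_le)
  have P_cube: "\<exists>\<alpha>. P \<Delta> = unit_cube \<alpha>" if "\<Delta> \<in> A" for \<Delta>
  proof -
    obtain \<alpha> where "P\<^sub>0 = unit_cube \<alpha>"
      using \<open>\<exists>\<alpha>. P\<^sub>0 = unit_cube \<alpha>\<close> ..
    moreover have "P \<Delta> = (\<lambda>X. X + \<Delta>) ` P\<^sub>0"
      using that assms(13) \<open>A \<subseteq> integer_matrices\<close> by auto
    ultimately show ?thesis
      by (auto simp: unit_cube_translate)
  qed
  then have P_borel: "P \<Delta> \<in> sets borel" if "\<Delta> \<in> A" for \<Delta>
    using that borel_unit_cube by fastforce
  have piece: "measure \<mu> (E \<inter> P \<Delta>) \<le> enn2real (Lp_norm p (P \<Delta>) f) * t" if "\<Delta> \<in> A" for \<Delta>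
  proof -
    obtain \<alpha> where \<alpha>: "P \<Delta> = unit_cube \<alpha>"
      using P_cube \<open>\<Delta> \<in> A\<close> by blast
    have "emeasure lborel (E \<inter> P \<Delta>) = emeasure lborel (\<Union>a\<in>I. P \<Delta> \<inter> N a)"
      by (rule arg_cong[where f = "emeasure lborel"]) (auto simp: E_def)
    also have "\<dots> \<le> ennreal (\<Sum>\<^sub>\<infinity>a\<in>I. (2 * \<kappa>) ^ CARD('m) * \<Psi> a ^ CARD('m))"
    proof (rule emeasure_UN_le_infsum)
      fix a assume "a \<in> I"
      then have "emeasure lborel (P \<Delta> \<inter> N a) \<le> ennreal ((2 * (\<kappa> * \<Psi> a)) ^ CARD('m))"
        unfolding \<alpha> N_def using half \<open>0 \<le> \<kappa>\<close> \<Psi>_nonneg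
        by (intro emeasure_unit_cube_int_dist_le) (simp_all add: I_def)
      also have "(2 * (\<kappa> * \<Psi> a)) ^ CARD('m) = (2 * \<kappa>) ^ CARD('m) * \<Psi> a ^ CARD('m)"
        by (simp add: power_mult_distrib)
      finally show "emeasure lborel (P \<Delta> \<inter> N a) \<le> ennreal ((2 * \<kappa>) ^ CARD('m) * \<Psi> a ^ CARD('m))" .
      show "P \<Delta> \<inter> N a \<in> sets lborel"
        using N_borel P_borel \<open>\<Delta> \<in> A\<close> by simp
      show "0 \<le> (2 * \<kappa>) ^ CARD('m) * \<Psi> a ^ CARD('m)"
        using \<open>0 \<le> \<kappa>\<close> \<Psi>_nonneg by simp
    next
      show "(\<lambda>a. (2 * \<kappa>) ^ CARD('m) * \<Psi> a ^ CARD('m)) summable_on I"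
        using summable by (rule summable_on_cmult_right)
    qed
    also have "(\<Sum>\<^sub>\<infinity>a\<in>I. (2 * \<kappa>) ^ CARD('m) * \<Psi> a ^ CARD('m)) = (2 * \<kappa>) ^ CARD('m) * S_\<Psi>"
      unfolding \<open>S_\<Psi> = _\<close> I_def[symmetric] using summable by (intro infsum_cmult_right)
    finally have "emeasure lborel (E \<inter> P \<Delta>) \<le> ennreal (t powr q)"
      using volume by (meson ennreal_leI order_trans)
    then have "(\<integral>\<^sup>+X\<in>E \<inter> P \<Delta>. ennreal (f X) \<partial>lborel) \<le> ennreal (enn2real (Lp_norm p (P \<Delta>) f) * t)"
      using \<open>\<Delta> \<in> A\<close> \<open>1 < p\<close> \<open>0 \<le> t\<close> assms(18,20) P_borel E_borel
      by (intro set_nn_integral_le_Lp_norm[where q = q]) auto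
    moreover have "emeasure \<mu> (E \<inter> P \<Delta>) = (\<integral>\<^sup>+X\<in>E \<inter> P \<Delta>. ennreal (f X) \<partial>lborel)"
      unfolding \<open>\<mu> = _\<close> using E_borel P_borel[OF \<open>\<Delta> \<in> A\<close>] by (subst emeasure_density) auto
    ultimately have "ennreal (measure \<mu> (E \<inter> P \<Delta>)) \<le> ennreal (enn2real (Lp_norm p (P \<Delta>) f) * t)"
      by (simp add: emeasure_eq_measure)
    then show ?thesis
      using \<open>0 \<le> t\<close> by (subst (asm) ennreal_le_iff) auto
  qed
  define U where "U = (\<Union>\<Delta>\<in>A. P \<Delta>)"
  have U_borel: "U \<in> sets borel"
    unfolding U_def using \<open>finite A\<close> P_borel by (intro sets.finite_UN) auto
  have "measure \<mu> (E \<inter> U) = measure \<mu> (\<Union>\<Delta>\<in>A. E \<inter> P \<Delta>)"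
    by (simp add: U_def)
  also have "\<dots> \<le> (\<Sum>\<Delta>\<in>A. measure \<mu> (E \<inter> P \<Delta>))"
    using \<open>finite A\<close> P_borel E_borel
    by (intro finite_measure_subadditive_finite) (auto simp: sets_\<mu>)
  also have "\<dots> \<le> (\<Sum>\<Delta>\<in>A. enn2real (Lp_norm p (P \<Delta>) f) * t)"
    by (intro sum_mono piece)
  also have "\<dots> = S_f * t"
    by (simp add: \<open>S_f = _\<close> sum_distrib_right)
  \<comment> \<open>Equality holds unless \<open>S_f = 0\<close>, in which case the left side is
    0.\<close>
  also have "\<dots> \<le> \<delta> / 2"
    using \<open>0 < \<delta>\<close> by (simp add: t_def)
  finally have inside: "measure \<mu> (E \<inter> U) \<le> \<delta> / 2" .
  \<comment> \<open>Outside the chosen cubes nothing is known about \<open>E\<close>, so the whole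
    complement of \<open>U\<close> is counted, with measure below
    \<open>\<delta> / 2\<close>.\<close>
  have "measure \<mu> E \<le> measure \<mu> ((E \<inter> U) \<union> (space \<mu> - U))"
    using E_borel U_borel by (intro finite_measure_mono) (auto simp: sets_\<mu> space_\<mu>)
  also have "\<dots> \<le> measure \<mu> (E \<inter> U) + measure \<mu> (space \<mu> - U)"
    using E_borel U_borel by (intro measure_Un_le) (auto simp: sets_\<mu> space_\<mu>)
  also have "measure \<mu> (space \<mu> - U) = 1 - measure \<mu> U"
    using U_borel by (intro prob_compl) (simp add: sets_\<mu>)
  finally have "measure \<mu> E \<le> \<delta>"
    using inside \<open>measure \<mu> (\<Union>\<Delta>\<in>A. P \<Delta>) > 1 - \<delta> / 2\<close> by (simp add: U_def)
  moreover have "measure \<mu> (- E) = 1 - measure \<mu> E"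
    using prob_compl[of E] E_borel by (simp add: sets_\<mu> space_\<mu> Compl_eq_Diff_UNIV)
  ultimately show ?thesis
    by (simp add: badly_approx_eq)
qed

end
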